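(* Let $(\mathfrak{g},\Omega,\vartheta)$ be a $2n$-dimensional lcs Lie algebra with a Lagrangian ideal $\mathfrak{j}\subset\ker\vartheta$. Then $\mathfrak{g}$ is a solution of the cotangent extension problem in the lcs context: there exist a Lie algebra $\mathfrak{h}$ with a closed $\hat\vartheta\in\mathfrak{h}^*$, and a Lie algebra structure on $\mathfrak{h}^*\oplus\mathfrak{h}$ solving the cotangent extension problem for $(\mathfrak{h},\hat\vartheta)$, such that $(\mathfrak{g},\Omega,\vartheta)$ is isomorphic, as an lcs Lie algebra, to $(\mathfrak{h}^*\oplus\mathfrak{h},\Omega_0,\vartheta_0)$.
   Context: Lie algebras are real and finite-dimensional; $d$ is the Chevalley–Eilenberg differential. An lcs Lie algebra $(\mathfrak{g},\Omega,\vartheta)$ is a Lie algebra of dimension $2n\ge4$ with $\Omega\in\Lambda^2\mathfrak{g}^*$, $\vartheta\in\mathfrak{g}^*$, $\Omega^n\ne0$, $d\vartheta=0$, $d\Omega=\vartheta\wedge\Omega$. A Lagrangian ideal is an $n$-dimensional ideal $\mathfrak{j}$ with $\Omega|_{\mathfrak{j}\times\mathfrak{j}}=0$. An isomorphism of lcs Lie algebras is a Lie algebra isomorphism pulling back the 2-form and the 1-form to the 2-form and the 1-form. Given a Lie algebra $\mathfrak{h}$ with closed $\hat\vartheta\in\mathfrak{h}^*$, define on the vector space $\mathfrak{h}^*\oplus\mathfrak{h}$ the forms $\vartheta_0(\varphi,X)=\hat\vartheta(X)$ and $\Omega_0((\varphi,X),(\psi,Y))=\varphi(Y)-\psi(X)$.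 A solution of the cotangent extension problem in the lcs context for $(\mathfrak{h},\hat\vartheta)$ is a Lie algebra structure on $\mathfrak{h}^*\oplus\mathfrak{h}$ such that (i) $0\to\mathfrak{h}^*\to\mathfrak{h}^*\oplus\mathfrak{h}\to\mathfrak{h}\to0$ is a short exact sequence of Lie algebras, with $\mathfrak{h}^*$ abelian; (ii) $d\vartheta_0=0$ and $d\Omega_0=\vartheta_0\wedge\Omega_0$. *)

theory Defs
  imports
    "HOL-Analysis.Analysis"
    "HOL-Combinatorics.Permutations"
    "HOL-Library.Function_Algebras"
begin

text \<open>
  Vector spaces are subspaces of an ambient real vector space type, so that statements can
  quantify over them. The dual of \<open>V\<close> consists of functions on the ambient type, hence the
  pointwise vector space structure on functions.
\<close>

instantiation "fun" :: (type, real_vector) real_vector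
begin

definition "scaleR c (f :: 'a \<Rightarrow> 'b) = (\<lambda>x. c *\<^sub>R f x)"

instance
  by standard (auto simp: scaleR_fun_def fun_eq_iff scaleR_add_right scaleR_add_left)

end

definition finite_dim_subspace :: "'a::real_vector set \<Rightarrow> bool" where
  "finite_dim_subspace V \<longleftrightarrow> subspace V \<and> (\<exists>B. finite B \<and> V = span B)"

definition lin_on :: "'a::real_vector set \<Rightarrow> ('a \<Rightarrow> 'b::real_vector) \<Rightarrow> bool" where
  "lin_on V f \<longleftrightarrow>
     (\<forall>x\<in>V. \<forall>y\<in>V. f (x + y) = f x + f y) \<and> (\<forall>c. \<forall>x\<in>V. f (c *\<^sub>R x) = c *\<^sub>R f x)"

definition alt_bilin_on :: "'a::real_vector set \<Rightarrow> ('a \<Rightarrow> 'a \<Rightarrow> 'b::real_vector) \<Rightarrow> bool" where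
  "alt_bilin_on V b \<longleftrightarrow>
     (\<forall>x\<in>V. lin_on V (b x)) \<and> (\<forall>y\<in>V. lin_on V (\<lambda>x. b x y)) \<and> (\<forall>x\<in>V. b x x = 0)"

text \<open>
  A functional on \<open>V\<close> is represented by its extension by \<open>0\<close> to the ambient type; this makes
  equality in \<open>dual_space V\<close> the equality of functionals on \<open>V\<close>.
\<close>

definition dual_space :: "'a::real_vector set \<Rightarrow> ('a \<Rightarrow> real) set" where
  "dual_space V = {\<phi>. lin_on V \<phi> \<and> (\<forall>x. x \<notin> V \<longrightarrow> \<phi> x = 0)}"

definition lie_algebra_on :: "'a::real_vector set \<Rightarrow> ('a \<Rightarrow> 'a \<Rightarrow> 'a) \<Rightarrow> bool" where
  "lie_algebra_on V br \<longleftrightarrow>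
     finite_dim_subspace V \<and>
     (\<forall>x\<in>V. \<forall>y\<in>V. br x y \<in> V) \<and>
     alt_bilin_on V br \<and>
     (\<forall>x\<in>V. \<forall>y\<in>V. \<forall>z\<in>V. br x (br y z) + br y (br z x) + br z (br x y) = 0)"

definition lie_hom_on ::
  "'a::real_vector set \<Rightarrow> ('a \<Rightarrow> 'a \<Rightarrow> 'a) \<Rightarrow> 'b::real_vector set \<Rightarrow> ('b \<Rightarrow> 'b \<Rightarrow> 'b) \<Rightarrow>
   ('a \<Rightarrow> 'b) \<Rightarrow> bool" where
  "lie_hom_on V br W br' f \<longleftrightarrow>
     f ` V \<subseteq> W \<and> lin_on V f \<and> (\<forall>x\<in>V. \<forall>y\<in>V. f (br x y) = br' (f x) (f y))"

definition lie_ideal :: "'a::real_vector set \<Rightarrow> ('a \<Rightarrow> 'a \<Rightarrow> 'a) \<Rightarrow> 'a set \<Rightarrow> bool" where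
  "lie_ideal V br J \<longleftrightarrow> subspace J \<and> J \<subseteq> V \<and> (\<forall>x\<in>V. \<forall>y\<in>J. br x y \<in> J)"

definition lie_short_exact ::
  "'a::real_vector set \<Rightarrow> ('a \<Rightarrow> 'a \<Rightarrow> 'a) \<Rightarrow> ('a \<Rightarrow> 'b) \<Rightarrow>
   'b::real_vector set \<Rightarrow> ('b \<Rightarrow> 'b \<Rightarrow> 'b) \<Rightarrow> ('b \<Rightarrow> 'c) \<Rightarrow>
   'c::real_vector set \<Rightarrow> ('c \<Rightarrow> 'c \<Rightarrow> 'c) \<Rightarrow> bool" where
  "lie_short_exact A brA i B brB p C brC \<longleftrightarrow>
     lie_algebra_on A brA \<and> lie_algebra_on B brB \<and> lie_algebra_on C brC \<and>
     lie_hom_on A brA B brB i \<and> lie_hom_on B brB C brC p \<and>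
     inj_on i A \<and> i ` A = {x \<in> B. p x = 0} \<and> p ` B = C"

text \<open>
  A \<open>k\<close>-form is evaluated on lists of length \<open>k\<close>; its values on other lists are irrelevant.
  The wedge product of a \<open>p\<close>-form and a \<open>q\<close>-form is normalised by \<open>1/(p! q!)\<close>, so that
  \<open>(\<alpha> \<and> \<beta>)(x, y) = \<alpha>(x) \<beta>(y) - \<alpha>(y) \<beta>(x)\<close> for 1-forms.
\<close>

type_synonym 'a form = "'a list \<Rightarrow> real"

definition form1 :: "('a \<Rightarrow> real) \<Rightarrow> 'a form" where
  "form1 \<alpha> = (\<lambda>v. \<alpha> (v ! 0))"

definition form2 :: "('a \<Rightarrow> 'a \<Rightarrow> real) \<Rightarrow> 'a form" where
  "form2 \<omega> = (\<lambda>v. \<omega> (v ! 0) (v ! 1))"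

definition wedge :: "nat \<Rightarrow> nat \<Rightarrow> 'a form \<Rightarrow> 'a form \<Rightarrow> 'a form" where
  "wedge p q \<alpha> \<beta> = (\<lambda>v.
     (\<Sum>\<sigma> | \<sigma> permutes {..<p + q}.
        of_int (sign \<sigma>) * \<alpha> (map (\<lambda>i. v ! \<sigma> i) [0..<p]) * \<beta> (map (\<lambda>i. v ! \<sigma> i) [p..<p + q]))
     / (fact p * fact q))"

primrec wedge_power :: "nat \<Rightarrow> 'a form \<Rightarrow> nat \<Rightarrow> 'a form" where
  "wedge_power k \<alpha> 0 = (\<lambda>_. 1)"
| "wedge_power k \<alpha> (Suc m) = wedge k (k * m) \<alpha> (wedge_power k \<alpha> m)"

text \<open>
  The Chevalley--Eilenberg differential (trivial coefficients):
  \<open>d\<omega>(v\<^sub>0, \<dots>, v\<^sub>k) = (\<Sum>i<j. (-1)\<^bsup>i+j\<^esup> \<omega>([v\<^sub>i, v\<^sub>j], v\<^sub>0, \<dots>, v\<^sub>k))\<close> with \<open>v\<^sub>i\<close> and \<open>v\<^sub>j\<close> omitted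
  from the remaining arguments.
\<close>

definition ce_d :: "('a \<Rightarrow> 'a \<Rightarrow> 'a) \<Rightarrow> 'a form \<Rightarrow> 'a form" where
  "ce_d br \<omega> = (\<lambda>v.
     \<Sum>j<length v. \<Sum>i<j. (-1) ^ (i + j) * \<omega> (br (v ! i) (v ! j) # nths v (- {i, j})))"

definition form_eq_on :: "'a set \<Rightarrow> nat \<Rightarrow> 'a form \<Rightarrow> 'a form \<Rightarrow> bool" where
  "form_eq_on V k \<alpha> \<beta> \<longleftrightarrow> (\<forall>v. length v = k \<and> set v \<subseteq> V \<longrightarrow> \<alpha> v = \<beta> v)"

definition closed_1form_on :: "'a set \<Rightarrow> ('a \<Rightarrow> 'a \<Rightarrow> 'a) \<Rightarrow> ('a \<Rightarrow> real) \<Rightarrow> bool" where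
  "closed_1form_on V br \<theta> \<longleftrightarrow> form_eq_on V 2 (ce_d br (form1 \<theta>)) (\<lambda>_. 0)"

definition lcs_eq_on ::
  "'a set \<Rightarrow> ('a \<Rightarrow> 'a \<Rightarrow> 'a) \<Rightarrow> ('a \<Rightarrow> 'a \<Rightarrow> real) \<Rightarrow> ('a \<Rightarrow> real) \<Rightarrow> bool" where
  "lcs_eq_on V br \<Omega> \<theta> \<longleftrightarrow>
     form_eq_on V 3 (ce_d br (form2 \<Omega>)) (wedge 1 2 (form1 \<theta>) (form2 \<Omega>))"

definition lcs_lie_algebra ::
  "nat \<Rightarrow> 'a::real_vector set \<Rightarrow> ('a \<Rightarrow> 'a \<Rightarrow> 'a) \<Rightarrow> ('a \<Rightarrow> 'a \<Rightarrow> real) \<Rightarrow> ('a \<Rightarrow> real) \<Rightarrow> bool" where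
  "lcs_lie_algebra n V br \<Omega> \<theta> \<longleftrightarrow>
     lie_algebra_on V br \<and> dim V = 2 * n \<and> 2 * n \<ge> 4 \<and>
     alt_bilin_on V \<Omega> \<and> lin_on V \<theta> \<and>
     \<not> form_eq_on V (2 * n) (wedge_power 2 (form2 \<Omega>) n) (\<lambda>_. 0) \<and>
     closed_1form_on V br \<theta> \<and> lcs_eq_on V br \<Omega> \<theta>"

definition lagrangian_ideal ::
  "nat \<Rightarrow> 'a::real_vector set \<Rightarrow> ('a \<Rightarrow> 'a \<Rightarrow> 'a) \<Rightarrow> ('a \<Rightarrow> 'a \<Rightarrow> real) \<Rightarrow> 'a set \<Rightarrow> bool" where
  "lagrangian_ideal n V br \<Omega> J \<longleftrightarrow>
     lie_ideal V br J \<and> dim J = n \<and> (\<forall>x\<in>J. \<forall>y\<in>J. \<Omega> x y = 0)"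

definition lcs_isomorphic ::
  "nat \<Rightarrow>
   'a::real_vector set \<Rightarrow> ('a \<Rightarrow> 'a \<Rightarrow> 'a) \<Rightarrow> ('a \<Rightarrow> 'a \<Rightarrow> real) \<Rightarrow> ('a \<Rightarrow> real) \<Rightarrow>
   'b::real_vector set \<Rightarrow> ('b \<Rightarrow> 'b \<Rightarrow> 'b) \<Rightarrow> ('b \<Rightarrow> 'b \<Rightarrow> real) \<Rightarrow> ('b \<Rightarrow> real) \<Rightarrow> bool" where
  "lcs_isomorphic n V br \<Omega> \<theta> W br' \<Omega>' \<theta>' \<longleftrightarrow>
     lcs_lie_algebra n V br \<Omega> \<theta> \<and> lcs_lie_algebra n W br' \<Omega>' \<theta>' \<and>
     (\<exists>f. lie_hom_on V br W br' f \<and> bij_betw f V W \<and>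
          (\<forall>x\<in>V. \<forall>y\<in>V. \<Omega>' (f x) (f y) = \<Omega> x y) \<and> (\<forall>x\<in>V. \<theta>' (f x) = \<theta> x))"

definition cotangent_space :: "'a::real_vector set \<Rightarrow> (('a \<Rightarrow> real) \<times> 'a) set" where
  "cotangent_space H = dual_space H \<times> H"

definition cotangent_theta :: "('a \<Rightarrow> real) \<Rightarrow> ('a \<Rightarrow> real) \<times> 'a \<Rightarrow> real" where
  "cotangent_theta \<theta>h = (\<lambda>(\<phi>, X). \<theta>h X)"

definition cotangent_Omega :: "('a \<Rightarrow> real) \<times> 'a \<Rightarrow> ('a \<Rightarrow> real) \<times> 'a \<Rightarrow> real" where
  "cotangent_Omega = (\<lambda>(\<phi>, X) (\<psi>, Y). \<phi> Y - \<psi> X)"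

definition solves_cotangent_extension ::
  "'a::real_vector set \<Rightarrow> ('a \<Rightarrow> 'a \<Rightarrow> 'a) \<Rightarrow> ('a \<Rightarrow> real) \<Rightarrow>
   (('a \<Rightarrow> real) \<times> 'a \<Rightarrow> ('a \<Rightarrow> real) \<times> 'a \<Rightarrow> ('a \<Rightarrow> real) \<times> 'a) \<Rightarrow> bool" where
  "solves_cotangent_extension H brh \<theta>h br \<longleftrightarrow>
     lie_algebra_on (cotangent_space H) br \<and>
     lie_short_exact (dual_space H) (\<lambda>_ _. 0) (\<lambda>\<phi>. (\<phi>, 0)) (cotangent_space H) br snd H brh \<and>
     closed_1form_on (cotangent_space H) br (cotangent_theta \<theta>h) \<and>
     lcs_eq_on (cotangent_space H) br cotangent_Omega (cotangent_theta \<theta>h)"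

end

theory Submission
  imports Defs
begin

text \<open>
  The form \<open>\<Omega>\<close> is nondegenerate, and evaluating \<open>d\<Omega> = \<theta> \<and> \<Omega>\<close> on two vectors of \<open>J\<close> and an arbitrary
  third one shows that \<open>J\<close> is abelian. For a complement \<open>K\<close> of \<open>J\<close>, with projection \<open>P\<close> along \<open>J\<close>,
  the bracket of \<open>G/J\<close> becomes \<open>P [x, y]\<close> on \<open>K\<close>, and \<open>\<Omega>\<close> identifies \<open>J\<close> with \<open>K\<^sup>*\<close>. The complement
  need not be Lagrangian: the map \<open>x \<mapsto> (\<Omega>(x - P x, \<cdot>) + 1/2 \<Omega>(P x, \<cdot>), P x)\<close> from \<open>G\<close> to
  \<open>K\<^sup>* \<oplus> K\<close> already pulls the canonical 2-form back to \<open>\<Omega>\<close>, since the correction term accounts for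
  \<open>\<Omega>\<close> restricted to \<open>K\<close>. The bracket on \<open>K\<^sup>* \<oplus> K\<close> is transported along this isomorphism.
\<close>

section \<open>Linear and alternating maps on a subspace\<close>

lemma lin_on_add: "lin_on V f \<Longrightarrow> x \<in> V \<Longrightarrow> y \<in> V \<Longrightarrow> f (x + y) = f x + f y"
  by (simp add: lin_on_def)

lemma lin_on_scale: "lin_on V f \<Longrightarrow> x \<in> V \<Longrightarrow> f (c *\<^sub>R x) = c *\<^sub>R f x"
  by (simp add: lin_on_def)

lemma lin_on_zero:
  assumes "lin_on V f" "subspace V"
  shows "f 0 = 0"
  using lin_on_scale[OF assms(1) subspace_0[OF assms(2)], of 0] by simp

lemma lin_on_diff:
  assumes "lin_on V f" "subspace V" "x \<in> V" "y \<in> V"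
  shows "f (x - y) = f x - f y"
  using lin_on_add[OF assms(1), of "x - y" y] assms by (simp add: subspace_diff)

lemma lin_on_sum:
  assumes "lin_on V f" "subspace V" "\<And>i. i \<in> I \<Longrightarrow> g i \<in> V"
  shows "f (\<Sum>i\<in>I. c i *\<^sub>R g i) = (\<Sum>i\<in>I. c i *\<^sub>R f (g i))"
  using assms(3)
proof (induction I rule: infinite_finite_induct)
  case (insert i I)
  then show ?case
    using assms(1,2)
    by (simp add: lin_on_add lin_on_scale subspace_sum subspace_scale)
qed (use lin_on_zero[OF assms(1,2)] in simp_all)

lemma lin_on_subset: "lin_on V f \<Longrightarrow> U \<subseteq> V \<Longrightarrow> lin_on U f"
  unfolding lin_on_def by blast

lemma lin_on_cong:
  assumes "subspace V" "\<And>x. x \<in> V \<Longrightarrow> f x = g x"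
  shows "lin_on V f \<longleftrightarrow> lin_on V g"
  using assms unfolding lin_on_def by (simp add: subspace_add subspace_scale)

lemma alt_bilin_on_cong:
  assumes "subspace V" "\<And>x y. x \<in> V \<Longrightarrow> y \<in> V \<Longrightarrow> b x y = c x y"
  shows "alt_bilin_on V b \<longleftrightarrow> alt_bilin_on V c"
proof -
  have "lin_on V (b x) \<longleftrightarrow> lin_on V (c x)" "lin_on V (\<lambda>y. b y x) \<longleftrightarrow> lin_on V (\<lambda>y. c y x)"
    if "x \<in> V" for x
    using assms that by (intro lin_on_cong; simp)+
  then show ?thesis
    using assms(2) unfolding alt_bilin_on_def by simp
qed

lemma lin_on_sum_divide:
  fixes h :: "'i \<Rightarrow> 'a::real_vector \<Rightarrow> real"
  assumes "\<And>i. i \<in> I \<Longrightarrow> lin_on V (h i)"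
  shows "lin_on V (\<lambda>x. (\<Sum>i\<in>I. h i x) / c)"
  unfolding lin_on_def
proof (intro conjI ballI allI)
  fix x y assume "x \<in> V" "y \<in> V"
  then have "(\<Sum>i\<in>I. h i (x + y)) = (\<Sum>i\<in>I. h i x + h i y)"
    by (intro sum.cong) (simp_all add: lin_on_add[OF assms])
  then show "(\<Sum>i\<in>I. h i (x + y)) / c = (\<Sum>i\<in>I. h i x) / c + (\<Sum>i\<in>I. h i y) / c"
    by (simp add: sum.distrib add_divide_distrib)
next
  fix a x assume "x \<in> V"
  then have "(\<Sum>i\<in>I. h i (a *\<^sub>R x)) = (\<Sum>i\<in>I. a * h i x)"
    by (intro sum.cong) (simp_all add: lin_on_scale[OF assms])
  then show "(\<Sum>i\<in>I. h i (a *\<^sub>R x)) / c = a *\<^sub>R ((\<Sum>i\<in>I. h i x) / c)"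
    by (simp add: sum_distrib_left)
qed

text \<open>Prescribing the values on a basis of \<open>V\<close> gives a map that is linear on the
  whole type, and induction over the span shows agreement on \<open>V\<close>. Facts about
  \<open>linear\<close> maps, such as those on images of spans, thereby apply to maps that are
  linear only on a subspace.\<close>

lemma lin_on_extend:
  fixes f :: "'a::real_vector \<Rightarrow> 'b::real_vector"
  assumes "lin_on V f" "subspace V"
  obtains h where "linear h" "\<And>x. x \<in> V \<Longrightarrow> h x = f x"
proof -
  obtain B where B: "B \<subseteq> V" "independent B" "V \<subseteq> span B"
    using basis_exists[of V] by metis
  obtain h where h: "linear h" "\<forall>b\<in>B. h b = f b"
    using linear_independent_extend[OF B(2)] by blast
  have "x \<in> V \<and> h x = f x" if "x \<in> span B" for x
    using that
  proof (induction rule: span_induct_alt)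
    case base
    then show ?case
      using lin_on_zero[OF assms] linear_0[OF h(1)] subspace_0[OF assms(2)] by simp
  next
    case (step c b y)
    then show ?case
      using subsetD[OF B(1) step(1)] h(2) assms(2)
      by (simp add: linear_add[OF h(1)] linear_scale[OF h(1)] lin_on_add[OF assms(1)]
          lin_on_scale[OF assms(1)] subspace_scale subspace_add)
  qed
  then show thesis
    using that h(1) B(3) by blast
qed

lemma finite_dim_subspace_image:
  fixes f :: "'a::real_vector \<Rightarrow> 'b::real_vector"
  assumes "lin_on V f" "finite_dim_subspace V"
  shows "finite_dim_subspace (f ` V)"
proof -
  obtain B where B: "subspace V" "finite B" "V = span B"
    using assms(2) unfolding finite_dim_subspace_def by blast
  obtain h where h: "linear h" "\<And>x. x \<in> V \<Longrightarrow> h x = f x"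
    using lin_on_extend[OF assms(1) B(1)] by blast
  have "f ` V = span (h ` B)"
    using h B(3) by (metis image_cong linear_span_image)
  then show ?thesis
    unfolding finite_dim_subspace_def using B(2) by auto
qed

lemma dim_image_lin_on:
  fixes f :: "'a::real_vector \<Rightarrow> 'b::real_vector"
  assumes "lin_on V f" "subspace V" "inj_on f V"
  shows "dim (f ` V) = dim V"
proof -
  obtain h where h: "linear h" "\<And>x. x \<in> V \<Longrightarrow> h x = f x"
    using lin_on_extend[OF assms(1,2)] by blast
  obtain B where B: "B \<subseteq> V" "independent B" "V \<subseteq> span B" "card B = dim V"
    using basis_exists[of V] by metis
  have V: "V = span B"
    using B(1,3) assms(2) by (simp add: span_minimal subset_antisym)
  have inj: "inj_on h (span B)"
    using assms(3) inj_on_cong[of V h f] h(2) V by simp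
  have "f ` V = span (h ` B)"
    using h V by (metis image_cong linear_span_image)
  moreover have "independent (h ` B)"
    using linear_independent_injective_image[OF h(1) B(2) inj] .
  moreover have "card (h ` B) = card B"
    using inj span_superset by (intro card_image) (rule inj_on_subset)
  ultimately show ?thesis
    using B(4) by (simp add: dim_eq_card_independent)
qed

text \<open>Steinitz exchange: an \<open>x\<close> in \<open>span E\<close> outside
  \<open>span S\<close> would make \<open>insert x S\<close> an independent subset of
  \<open>span E\<close> with more than \<open>card E\<close> elements.\<close>

lemma span_subset_span_if_card_le:
  assumes "independent S" "S \<subseteq> span E" "finite E" "card E \<le> card S"
  shows "span E \<subseteq> span S"
proof
  fix x assume x: "x \<in> span E"
  have S: "finite S"
    using independent_span_bound[OF assms(3,1,2)] by simp
  show "x \<in> span S"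
  proof (rule ccontr)
    assume nx: "x \<notin> span S"
    then have "x \<notin> S" "independent (insert x S)"
      using assms(1) span_base by (auto simp: independent_insert)
    then show False
      using independent_span_bound[of E "insert x S"] assms S x by simp
  qed
qed

section \<open>Wedge products\<close>

text \<open>Updating slot \<open>i\<close> overwrites the old entry, so \<open>v\<close> only
  supplies the other arguments. Alternation is kept apart and enters through
  \<open>wedge_repeated\<close>.\<close>

definition multilin_form :: "'a::real_vector set \<Rightarrow> nat \<Rightarrow> 'a form \<Rightarrow> bool" where
  "multilin_form V k \<alpha> \<longleftrightarrow>
     (\<forall>v i. length v = k \<and> set v \<subseteq> V \<and> i < k \<longrightarrow> lin_on V (\<lambda>x. \<alpha> (v[i := x])))"

text \<open>The set \<open>R\<close> is meant to be the radical of a 2-form; the property then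
  passes to the powers of that form.\<close>

definition vanishes_on :: "'a set \<Rightarrow> 'a set \<Rightarrow> nat \<Rightarrow> 'a form \<Rightarrow> bool" where
  "vanishes_on V R k \<alpha> \<longleftrightarrow>
     (\<forall>v. length v = k \<and> set v \<subseteq> V \<and> set v \<inter> R \<noteq> {} \<longrightarrow> \<alpha> v = 0)"

lemma permutes_nth_mem:
  assumes "\<sigma> permutes {..<p + q}" "length v = p + q" "set v \<subseteq> V" "l < p + q"
  shows "v ! \<sigma> l \<in> V"
  using assms permutes_in_image[OF assms(1), of l] by (auto intro: subsetD[OF assms(3)])

text \<open>In each summand, slot \<open>i\<close> is read at the unique position \<open>j\<close>
  with \<open>\<sigma> j = i\<close>. This position belongs to one factor only, so that factor is
  linear in \<open>x\<close> and the other is constant.\<close>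

lemma multilin_form_wedge:
  assumes \<alpha>: "multilin_form V p \<alpha>" and \<beta>: "multilin_form V q \<beta>"
  shows "multilin_form V (p + q) (wedge p q \<alpha> \<beta>)"
  unfolding multilin_form_def
proof (intro allI impI)
  fix v i
  assume v: "length v = p + q \<and> set v \<subseteq> V \<and> i < p + q"
  let ?a = "\<lambda>\<sigma>. map (\<lambda>l. v ! \<sigma> l) [0..<p]" and ?b = "\<lambda>\<sigma>. map (\<lambda>l. v ! \<sigma> l) [p..<p + q]"
  let ?T = "\<lambda>\<sigma> x. of_int (sign \<sigma>) * \<alpha> (map (\<lambda>l. v[i := x] ! \<sigma> l) [0..<p]) *
    \<beta> (map (\<lambda>l. v[i := x] ! \<sigma> l) [p..<p + q])"
  have T: "lin_on V (?T \<sigma>)" if \<sigma>: "\<sigma> permutes {..<p + q}" for \<sigma>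
  proof -
    obtain j where j: "\<sigma> j = i" "j < p + q"
      using v permutes_image[OF \<sigma>] by (metis imageE lessThan_iff)
    have eq: "\<sigma> l = i \<longleftrightarrow> l = j" for l
      using j(1) permutes_inj[OF \<sigma>] by (auto dest: injD)
    have nth: "v[i := x] ! \<sigma> l = (if l = j then x else v ! \<sigma> l)" for x l
      using eq[of l] v by (cases "l = j") auto
    have sets: "set (?a \<sigma>) \<subseteq> V" "set (?b \<sigma>) \<subseteq> V"
      using permutes_nth_mem[OF \<sigma>, where v = v and V = V] v by auto
    show ?thesis
    proof (cases "j < p")
      case True
      have "map (\<lambda>l. v[i := x] ! \<sigma> l) [0..<p] = (?a \<sigma>)[j := x]" for x
        by (rule nth_equalityI) (auto simp: nth nth_list_update)
      moreover have "map (\<lambda>l. v[i := x] ! \<sigma> l) [p..<p + q] = ?b \<sigma>" for x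
        using True by (auto simp: nth)
      moreover have "lin_on V (\<lambda>x. \<alpha> ((?a \<sigma>)[j := x]))"
        using \<alpha> True sets unfolding multilin_form_def by simp
      ultimately show ?thesis
        by (simp only: lin_on_def) (simp add: algebra_simps)
    next
      case False
      have "map (\<lambda>l. v[i := x] ! \<sigma> l) [p..<p + q] = (?b \<sigma>)[j - p := x]" for x
        using False by (intro nth_equalityI) (auto simp: nth nth_list_update)
      moreover have "map (\<lambda>l. v[i := x] ! \<sigma> l) [0..<p] = ?a \<sigma>" for x
        using False by (auto simp: nth)
      moreover have "lin_on V (\<lambda>x. \<beta> ((?b \<sigma>)[j - p := x]))"
        using \<beta> False j sets unfolding multilin_form_def by simp
      ultimately show ?thesis
        by (simp only: lin_on_def) (simp add: algebra_simps)
    qed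
  qed
  have "lin_on V (\<lambda>x. (\<Sum>\<sigma> | \<sigma> permutes {..<p + q}. ?T \<sigma> x) / (fact p * fact q))"
    using T by (intro lin_on_sum_divide) simp
  then show "lin_on V (\<lambda>x. wedge p q \<alpha> \<beta> (v[i := x]))"
    unfolding wedge_def .
qed

text \<open>Every summand passes the entry from \<open>R\<close> to one of its two factors, which
  then vanishes.\<close>

lemma vanishes_on_wedge:
  assumes \<alpha>: "vanishes_on V R p \<alpha>" and \<beta>: "vanishes_on V R q \<beta>"
  shows "vanishes_on V R (p + q) (wedge p q \<alpha> \<beta>)"
  unfolding vanishes_on_def
proof (intro allI impI)
  fix v
  assume v: "length v = p + q \<and> set v \<subseteq> V \<and> set v \<inter> R \<noteq> {}"
  then obtain i where i: "i < p + q" "v ! i \<in> R"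
    by (metis disjoint_iff in_set_conv_nth)
  have "\<alpha> (map (\<lambda>l. v ! \<sigma> l) [0..<p]) * \<beta> (map (\<lambda>l. v ! \<sigma> l) [p..<p + q]) = 0"
    if \<sigma>: "\<sigma> permutes {..<p + q}" for \<sigma>
  proof -
    obtain j where j: "\<sigma> j = i" "j < p + q"
      using i permutes_image[OF \<sigma>] by (metis imageE lessThan_iff)
    have sets: "set (map (\<lambda>l. v ! \<sigma> l) [0..<p]) \<subseteq> V" "set (map (\<lambda>l. v ! \<sigma> l) [p..<p + q]) \<subseteq> V"
      using permutes_nth_mem[OF \<sigma>, where v = v and V = V] v by auto
    show ?thesis
    proof (cases "j < p")
      case True
      then have "v ! i \<in> set (map (\<lambda>l. v ! \<sigma> l) [0..<p])"
        using j by force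
      then have "set (map (\<lambda>l. v ! \<sigma> l) [0..<p]) \<inter> R \<noteq> {}"
        using i(2) by blast
      then have "\<alpha> (map (\<lambda>l. v ! \<sigma> l) [0..<p]) = 0"
        using \<alpha> sets(1) unfolding vanishes_on_def by simp
      then show ?thesis by simp
    next
      case False
      then have "v ! i \<in> set (map (\<lambda>l. v ! \<sigma> l) [p..<p + q])"
        using j by force
      then have "set (map (\<lambda>l. v ! \<sigma> l) [p..<p + q]) \<inter> R \<noteq> {}"
        using i(2) by blast
      then have "\<beta> (map (\<lambda>l. v ! \<sigma> l) [p..<p + q]) = 0"
        using \<beta> sets(2) unfolding vanishes_on_def by simp
      then show ?thesis by simp
    qed
  qed
  then show "wedge p q \<alpha> \<beta> v = 0"
    unfolding wedge_def mult.assoc by (subst sum.neutral) (simp_all del: mult_eq_0_iff)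
qed

text \<open>Composition on the left with the transposition of \<open>i\<close> and \<open>j\<close>
  permutes the summands, reverses their signs and, the two entries being equal, changes no argument.
  The sum thus equals its own negative.\<close>

lemma wedge_repeated:
  assumes "i < p + q" "j < p + q" "i \<noteq> j" "v ! i = v ! j"
  shows "wedge p q \<alpha> \<beta> v = 0"
proof -
  let ?\<tau> = "Transposition.transpose i j"
  let ?T = "\<lambda>\<sigma>. of_int (sign \<sigma>) * \<alpha> (map (\<lambda>l. v ! \<sigma> l) [0..<p]) *
    \<beta> (map (\<lambda>l. v ! \<sigma> l) [p..<p + q])"
  have \<tau>: "?\<tau> permutes {..<p + q}"
    using assms by (intro permutes_swap_id) auto
  have v\<tau>: "v ! ?\<tau> l = v ! l" for l
    using assms(4) by (auto simp: Transposition.transpose_def)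
  have "?T (?\<tau> \<circ> \<sigma>) = - ?T \<sigma>" if "\<sigma> permutes {..<p + q}" for \<sigma>
  proof -
    have "permutation \<sigma>" "permutation ?\<tau>"
      using that \<tau> by (auto simp: permutation_permutes)
    then have "sign (?\<tau> \<circ> \<sigma>) = - sign \<sigma>"
      using assms(3) by (simp add: sign_compose sign_swap_id)
    then show ?thesis
      by (simp add: v\<tau>)
  qed
  then have "(\<Sum>\<sigma> | \<sigma> permutes {..<p + q}. ?T \<sigma>) = - (\<Sum>\<sigma> | \<sigma> permutes {..<p + q}. ?T \<sigma>)"
    using setum_permutations_compose_left[OF \<tau>, of ?T] by (simp add: sum_negf)
  then show ?thesis
    unfolding wedge_def by simp
qed

text \<open>Forms are unconstrained on lists of the wrong length or with entries off
  \<open>V\<close>, so compatibility with \<open>f\<close> is asked only where a summand evaluates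
  the factors.\<close>

lemma wedge_pullback:
  assumes "length v = p + q" "set v \<subseteq> V"
    and "\<And>w. length w = p \<Longrightarrow> set w \<subseteq> V \<Longrightarrow> \<alpha>' (map f w) = \<alpha> w"
    and "\<And>w. length w = q \<Longrightarrow> set w \<subseteq> V \<Longrightarrow> \<beta>' (map f w) = \<beta> w"
  shows "wedge p q \<alpha>' \<beta>' (map f v) = wedge p q \<alpha> \<beta> v"
proof -
  have "\<alpha>' (map (\<lambda>l. map f v ! \<sigma> l) [0..<p]) = \<alpha> (map (\<lambda>l. v ! \<sigma> l) [0..<p])"
    "\<beta>' (map (\<lambda>l. map f v ! \<sigma> l) [p..<p + q]) = \<beta> (map (\<lambda>l. v ! \<sigma> l) [p..<p + q])"
    if \<sigma>: "\<sigma> permutes {..<p + q}" for \<sigma>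
  proof -
    have \<sigma>l: "\<sigma> l < length v" if "l < p + q" for l
      using permutes_in_image[OF \<sigma>, of l] that assms(1) by simp
    have eq: "map (\<lambda>l. map f v ! \<sigma> l) [0..<p] = map f (map (\<lambda>l. v ! \<sigma> l) [0..<p])"
      "map (\<lambda>l. map f v ! \<sigma> l) [p..<p + q] = map f (map (\<lambda>l. v ! \<sigma> l) [p..<p + q])"
      using \<sigma>l by auto
    have "set (map (\<lambda>l. v ! \<sigma> l) [0..<p]) \<subseteq> V" "set (map (\<lambda>l. v ! \<sigma> l) [p..<p + q]) \<subseteq> V"
      using permutes_nth_mem[OF \<sigma> assms(1,2)] by auto
    then show "\<alpha>' (map (\<lambda>l. map f v ! \<sigma> l) [0..<p]) = \<alpha> (map (\<lambda>l. v ! \<sigma> l) [0..<p])"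
      "\<beta>' (map (\<lambda>l. map f v ! \<sigma> l) [p..<p + q]) = \<beta> (map (\<lambda>l. v ! \<sigma> l) [p..<p + q])"
      unfolding eq by (intro assms(3,4); simp)+
  qed
  then show ?thesis
    unfolding wedge_def by simp
qed

lemma wedge_power_pullback:
  assumes "length v = k * m" "set v \<subseteq> V"
    and "\<And>w. length w = k \<Longrightarrow> set w \<subseteq> V \<Longrightarrow> \<alpha>' (map f w) = \<alpha> w"
  shows "wedge_power k \<alpha>' m (map f v) = wedge_power k \<alpha> m v"
  using assms(1,2)
proof (induction m arbitrary: v)
  case (Suc m)
  then show ?case
    using assms(3) by (auto intro!: wedge_pullback[where V = V])
qed simp

lemma multilin_form_wedge_power:
  assumes "multilin_form V k \<alpha>"
  shows "multilin_form V (k * m) (wedge_power k \<alpha> m)"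
proof (induction m)
  case (Suc m)
  then show ?case
    using multilin_form_wedge[OF assms Suc] by simp
qed (simp add: multilin_form_def)

lemma vanishes_on_wedge_power:
  assumes "vanishes_on V R k \<alpha>"
  shows "vanishes_on V R (k * m) (wedge_power k \<alpha> m)"
proof (induction m)
  case (Suc m)
  then show ?case
    using vanishes_on_wedge[OF assms Suc] by simp
qed (simp add: vanishes_on_def)

lemma multilin_form_form2:
  assumes "alt_bilin_on V \<Omega>"
  shows "multilin_form V 2 (form2 \<Omega>)"
  unfolding multilin_form_def
proof (intro allI impI)
  fix v :: "'a list" and i :: nat
  assume v: "length v = 2 \<and> set v \<subseteq> V \<and> i < 2"
  then obtain a b where "v = [a, b]" "a \<in> V" "b \<in> V"
    by (auto simp: numeral_2_eq_2 length_Suc_conv)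
  moreover have "i = 0 \<or> i = 1"
    using v by auto
  ultimately show "lin_on V (\<lambda>x. form2 \<Omega> (v[i := x]))"
    using assms by (auto simp: form2_def alt_bilin_on_def)
qed

lemma alt_bilin_on_swap:
  assumes "alt_bilin_on V b" "subspace V" "x \<in> V" "y \<in> V"
  shows "b y x = - b x y"
proof -
  have l: "lin_on V (b x)" "lin_on V (b y)" "lin_on V (\<lambda>u. b u (x + y))"
    and z: "b x x = 0" "b y y = 0" "b (x + y) (x + y) = 0"
    using assms by (auto simp: alt_bilin_on_def subspace_add)
  have "b (x + y) (x + y) = (b x x + b x y) + (b y x + b y y)"
    using lin_on_add[OF l(3), of x y] lin_on_add[OF l(1), of x y] lin_on_add[OF l(2), of x y] assms
    by simp
  then show ?thesis
    using z by (simp add: eq_neg_iff_add_eq_0 add.commute)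
qed

text \<open>If some combination of the entries of \<open>v\<close> lies in the radical, substituting it for an
  entry with nonzero coefficient \<open>c\<close> multiplies the alternating form by \<open>c\<close> and also kills it.\<close>

lemma wedge_power_nonzero_imp_nondegenerate:
  assumes V: "finite_dim_subspace V" and \<Omega>: "alt_bilin_on V \<Omega>"
    and dimV: "dim V = 2 * n" and n: "n > 0"
    and ne: "\<not> form_eq_on V (2 * n) (wedge_power 2 (form2 \<Omega>) n) (\<lambda>_. 0)"
    and x: "x \<in> V" "\<And>y. y \<in> V \<Longrightarrow> \<Omega> x y = 0"
  shows "x = 0"
proof (rule ccontr)
  assume "x \<noteq> 0"
  define R where "R = {x \<in> V. \<forall>y\<in>V. \<Omega> x y = 0}"
  define W where "W = wedge_power 2 (form2 \<Omega>) n"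
  have sub: "subspace V"
    using V by (simp add: finite_dim_subspace_def)
  obtain v where v: "length v = 2 * n" "set v \<subseteq> V" "W v \<noteq> 0"
    using ne unfolding form_eq_on_def W_def by blast
  \<comment> \<open>Writing \<open>n\<close> as a successor exposes the outermost wedge, to which
    \<open>wedge_repeated\<close> applies.\<close>
  obtain m where m: "n = Suc m"
    using n gr0_implies_Suc by blast
  have "vanishes_on V R 2 (form2 \<Omega>)"
    unfolding vanishes_on_def
  proof (intro allI impI)
    fix w :: "'a list"
    assume w: "length w = 2 \<and> set w \<subseteq> V \<and> set w \<inter> R \<noteq> {}"
    then obtain a b where "w = [a, b]" "a \<in> V" "b \<in> V"
      by (auto simp: numeral_2_eq_2 length_Suc_conv)
    then show "form2 \<Omega> w = 0"
      using w alt_bilin_on_swap[OF \<Omega> sub, of a b] by (auto simp: form2_def R_def)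
  qed
  then have van: "vanishes_on V R (2 * n) W"
    unfolding W_def by (rule vanishes_on_wedge_power)
  have mul: "multilin_form V (2 * n) W"
    unfolding W_def by (intro multilin_form_wedge_power multilin_form_form2 \<Omega>)
  have rep: "W w = 0" if "i < 2 * n" "j < 2 * n" "i \<noteq> j" "w ! i = w ! j" for w i j
    using wedge_repeated[of i 2 "2 * m" j w] that by (simp add: W_def m)
  have dist: "distinct v"
    using rep v unfolding distinct_conv_nth by metis
  have R0: "0 \<in> R"
    using sub \<Omega> lin_on_zero[OF _ sub] unfolding R_def alt_bilin_on_def
    by (auto simp: subspace_0)
  \<comment> \<open>If the entries of \<open>v\<close> are independent, they form a basis, since
    there are \<open>dim V\<close> of them, and the nonzero radical vector \<open>x\<close> is a
    combination of them. Otherwise a nontrivial relation gives the combination \<open>0\<close>,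
    which also lies in \<open>R\<close>.\<close>
  obtain u k where u: "k < 2 * n" "u (v ! k) \<noteq> 0" "(\<Sum>w\<in>set v. u w *\<^sub>R w) \<in> R"
  proof (cases "independent (set v)")
    case True
    have "card (set v) = dim V"
      using dist v(1) dimV distinct_card by metis
    obtain B where B: "B \<subseteq> V" "independent B" "V \<subseteq> span B" "card B = dim V"
      using basis_exists[of V] by metis
    have "finite B"
      using B(4) dimV n by (intro card_ge_0_finite) simp
    then have "V \<subseteq> span (set v)"
      using span_subset_span_if_card_le[OF True _ \<open>finite B\<close>] B(3,4) v(2) \<open>card (set v) = dim V\<close>
      by (metis order.refl order.trans)
    then obtain u where "x = (\<Sum>w\<in>set v. u w *\<^sub>R w)"
      using x(1) span_finite[of "set v"] by auto
    then have xu: "(\<Sum>w\<in>set v. u w *\<^sub>R w) = x"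
      by simp
    have "\<exists>w\<in>set v. u w \<noteq> 0"
    proof (rule ccontr)
      assume "\<not> ?thesis"
      then have "(\<Sum>w\<in>set v. u w *\<^sub>R w) = 0"
        by (intro sum.neutral) simp
      then show False
        using xu \<open>x \<noteq> 0\<close> by simp
    qed
    then obtain k where "k < 2 * n" "u (v ! k) \<noteq> 0"
      using v(1) by (auto simp: in_set_conv_nth)
    then show ?thesis
      using that[of k u] x xu by (simp add: R_def)
  next
    case False
    then obtain u w where "w \<in> set v" "u w \<noteq> 0" "(\<Sum>w\<in>set v. u w *\<^sub>R w) = 0"
      using dependent_finite[of "set v"] by auto
    moreover from this obtain k where "k < 2 * n" "w = v ! k"
      using v(1) by (auto simp: in_set_conv_nth)
    ultimately show ?thesis
      using that[of k u] R0 by simp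
  qed
  let ?s = "\<Sum>w\<in>set v. u w *\<^sub>R w"
  have "set (v[k := ?s]) \<subseteq> V"
    using v(2) u(3) set_update_subset_insert[of v k ?s] by (auto simp: R_def)
  moreover have "?s \<in> set (v[k := ?s])"
    using u(1) v(1) by (simp add: set_update_memI)
  then have "set (v[k := ?s]) \<inter> R \<noteq> {}"
    using u(3) by blast
  ultimately have "W (v[k := ?s]) = 0"
    using van v(1) unfolding vanishes_on_def by simp
  moreover have "W (v[k := ?s]) = (\<Sum>w\<in>set v. u w *\<^sub>R W (v[k := w]))"
    using mul v u(1) sub unfolding multilin_form_def by (intro lin_on_sum[where V = V]) auto
  \<comment> \<open>Placing any other entry of \<open>v\<close> in slot \<open>k\<close> repeats
    that entry, so only the term of \<open>v ! k\<close> survives.\<close>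
  moreover have "\<dots> = (\<Sum>w\<in>set v. if w = v ! k then u w * W v else 0)"
  proof (rule sum.cong)
    fix w assume "w \<in> set v"
    then obtain i where i: "i < 2 * n" "w = v ! i"
      using v(1) by (metis in_set_conv_nth)
    show "u w *\<^sub>R W (v[k := w]) = (if w = v ! k then u w * W v else 0)"
    proof (cases "i = k")
      case False
      then show ?thesis
        using rep[OF i(1) u(1) False, of "v[k := w]"] i u(1) v(1) dist by (simp add: nth_eq_iff_index_eq)
    qed (use i in simp)
  qed simp
  moreover have "\<dots> = u (v ! k) * W v"
    using u(1) v(1) by simp
  ultimately show False
    using u(2) v(3) by simp
qed

section \<open>Transport of structure\<close>

lemma lin_on_image_iff:
  assumes "lin_on V f" "subspace V"
  shows "lin_on (f ` V) h \<longleftrightarrow> lin_on V (\<lambda>x. h (f x))"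
proof -
  have "f x + f y = f (x + y)" "c *\<^sub>R f x = f (c *\<^sub>R x)" if "x \<in> V" "y \<in> V" for x y c
    using that by (simp_all add: lin_on_add[OF assms(1)] lin_on_scale[OF assms(1)])
  then show ?thesis
    by (simp add: lin_on_def)
qed

lemma alt_bilin_on_image_iff:
  assumes "lin_on V f" "subspace V"
  shows "alt_bilin_on (f ` V) b \<longleftrightarrow> alt_bilin_on V (\<lambda>x y. b (f x) (f y))"
  by (simp add: alt_bilin_on_def lin_on_image_iff[OF assms])

text \<open>On two arguments the differential has the single term \<open>i = 0\<close>,
  \<open>j = 1\<close>, with sign -1.\<close>

lemma closed_1form_on_iff:
  "closed_1form_on V br \<theta> \<longleftrightarrow> (\<forall>x\<in>V. \<forall>y\<in>V. \<theta> (br x y) = 0)"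
proof -
  have "ce_d br (form1 \<theta>) [x, y] = - \<theta> (br x y)" for x y
    by (simp add: ce_d_def form1_def numeral_2_eq_2)
  moreover have "(\<forall>v. length v = 2 \<and> set v \<subseteq> V \<longrightarrow> Q v) \<longleftrightarrow> (\<forall>x\<in>V. \<forall>y\<in>V. Q [x, y])"
    for Q :: "'a list \<Rightarrow> bool"
    by (auto simp: numeral_2_eq_2 length_Suc_conv)
  ultimately show ?thesis
    unfolding closed_1form_on_def form_eq_on_def by simp
qed

text \<open>The pairs (0,1), (0,2), (1,2) carry the signs -, +, -, and each leaves one argument
  over.\<close>

lemma ce_d_form2:
  "ce_d br (form2 \<Omega>) [x, y, z] = - \<Omega> (br x y) z + \<Omega> (br x z) y - \<Omega> (br y z) x"
  by (simp add: ce_d_def form2_def numeral_3_eq_3 nths_Cons lessThan_Suc)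

text \<open>The wedge stays unexpanded: later arguments use only its compatibility with pullback and
  its vanishing on certain triples.\<close>

lemma lcs_eq_on_iff:
  "lcs_eq_on V br \<Omega> \<theta> \<longleftrightarrow> (\<forall>x\<in>V. \<forall>y\<in>V. \<forall>z\<in>V.
     - \<Omega> (br x y) z + \<Omega> (br x z) y - \<Omega> (br y z) x = wedge 1 2 (form1 \<theta>) (form2 \<Omega>) [x, y, z])"
proof -
  have "(\<forall>v. length v = 3 \<and> set v \<subseteq> V \<longrightarrow> Q v) \<longleftrightarrow> (\<forall>x\<in>V. \<forall>y\<in>V. \<forall>z\<in>V. Q [x, y, z])"
    for Q :: "'a list \<Rightarrow> bool"
    by (auto simp: numeral_3_eq_3 length_Suc_conv)
  then show ?thesis
    unfolding lcs_eq_on_def form_eq_on_def by (simp add: ce_d_form2)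
qed

lemma lie_algebra_on_transport:
  assumes V: "lie_algebra_on V br" and f: "lin_on V f" "inj_on f V"
    and br': "\<And>x y. x \<in> V \<Longrightarrow> y \<in> V \<Longrightarrow> br' (f x) (f y) = f (br x y)"
  shows "lie_algebra_on (f ` V) br'"
proof -
  have sub: "subspace V" and fin: "finite_dim_subspace V"
    using V by (auto simp: lie_algebra_on_def finite_dim_subspace_def)
  have cl: "br x y \<in> V" if "x \<in> V" "y \<in> V" for x y
    using V that by (simp add: lie_algebra_on_def)
  have alt: "alt_bilin_on V br"
    using V by (simp add: lie_algebra_on_def)
  have "alt_bilin_on V (\<lambda>x y. f (br x y))"
    using alt cl lin_on_zero[OF f(1) sub] f(1) unfolding alt_bilin_on_def lin_on_def by simp
  then have "alt_bilin_on V (\<lambda>x y. br' (f x) (f y))"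
    by (subst alt_bilin_on_cong[OF sub br'])
  moreover have "br' (f x) (br' (f y) (f z)) + br' (f y) (br' (f z) (f x)) + br' (f z) (br' (f x) (f y)) = 0"
    if "x \<in> V" "y \<in> V" "z \<in> V" for x y z
  proof -
    have "br' (f x) (br' (f y) (f z)) + br' (f y) (br' (f z) (f x)) + br' (f z) (br' (f x) (f y)) =
      f (br x (br y z) + br y (br z x) + br z (br x y))"
      using that sub by (simp add: br' cl lin_on_add[OF f(1)] subspace_add)
    also have "\<dots> = 0"
      using V that lin_on_zero[OF f(1) sub] by (simp add: lie_algebra_on_def)
    finally show ?thesis .
  qed
  ultimately show ?thesis
    unfolding lie_algebra_on_def
    using finite_dim_subspace_image[OF f(1) fin] cl
    by (simp add: alt_bilin_on_image_iff[OF f(1) sub] br')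
qed

text \<open>All conditions on an lcs Lie algebra pull back along \<open>f\<close> to conditions on
  \<open>V\<close>. The target therefore inherits closedness, the lcs equation and nondegeneracy,
  with no separate computation for the canonical forms.\<close>

lemma lcs_isomorphic_transport:
  assumes V: "lcs_lie_algebra n V br \<Omega> \<theta>" and f: "lin_on V f" "inj_on f V"
    and br': "\<And>x y. x \<in> V \<Longrightarrow> y \<in> V \<Longrightarrow> br' (f x) (f y) = f (br x y)"
    and \<Omega>': "\<And>x y. x \<in> V \<Longrightarrow> y \<in> V \<Longrightarrow> \<Omega>' (f x) (f y) = \<Omega> x y"
    and \<theta>': "\<And>x. x \<in> V \<Longrightarrow> \<theta>' (f x) = \<theta> x"
  shows "lcs_isomorphic n V br \<Omega> \<theta> (f ` V) br' \<Omega>' \<theta>'"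
proof -
  have lie: "lie_algebra_on V br" and alt: "alt_bilin_on V \<Omega>" and \<theta>: "lin_on V \<theta>"
    using V by (auto simp: lcs_lie_algebra_def)
  have sub: "subspace V" and cl: "\<And>x y. x \<in> V \<Longrightarrow> y \<in> V \<Longrightarrow> br x y \<in> V"
    using lie by (auto simp: lie_algebra_on_def finite_dim_subspace_def)
  have f1: "form1 \<theta>' (map f w) = form1 \<theta> w" if "length w = 1" "set w \<subseteq> V" for w
    using that \<theta>' by (auto simp: form1_def length_Suc_conv)
  have f2: "form2 \<Omega>' (map f w) = form2 \<Omega> w" if "length w = 2" "set w \<subseteq> V" for w
    using that \<Omega>' by (auto simp: form2_def numeral_2_eq_2 length_Suc_conv)
  have "alt_bilin_on V (\<lambda>x y. \<Omega>' (f x) (f y))"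
    using alt by (subst alt_bilin_on_cong[OF sub \<Omega>'])
  then have "alt_bilin_on (f ` V) \<Omega>'"
    by (simp add: alt_bilin_on_image_iff[OF f(1) sub])
  moreover have "lin_on (f ` V) \<theta>'"
    using \<theta> by (simp add: lin_on_image_iff[OF f(1) sub] lin_on_cong[OF sub \<theta>'])
  moreover have "\<not> form_eq_on (f ` V) (2 * n) (wedge_power 2 (form2 \<Omega>') n) (\<lambda>_. 0)"
  proof -
    obtain v where v: "length v = 2 * n" "set v \<subseteq> V" "wedge_power 2 (form2 \<Omega>) n v \<noteq> 0"
      using V unfolding lcs_lie_algebra_def form_eq_on_def by blast
    then have "wedge_power 2 (form2 \<Omega>') n (map f v) \<noteq> 0"
      using wedge_power_pullback[of v 2 n V "form2 \<Omega>'" f "form2 \<Omega>"] f2 by simp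
    moreover have "length (map f v) = 2 * n" "set (map f v) \<subseteq> f ` V"
      using v by auto
    ultimately show ?thesis
      unfolding form_eq_on_def by blast
  qed
  moreover have "closed_1form_on (f ` V) br' \<theta>'"
    using V cl by (simp add: lcs_lie_algebra_def closed_1form_on_iff br' \<theta>')
  moreover have "lcs_eq_on (f ` V) br' \<Omega>' \<theta>'"
  proof -
    have "wedge 1 2 (form1 \<theta>') (form2 \<Omega>') [f x, f y, f z] = wedge 1 2 (form1 \<theta>) (form2 \<Omega>) [x, y, z]"
      if "x \<in> V" "y \<in> V" "z \<in> V" for x y z
      using wedge_pullback[of "[x, y, z]" 1 2 V "form1 \<theta>'" f "form1 \<theta>" "form2 \<Omega>'" "form2 \<Omega>"]
        that f1 f2 by simp
    then show ?thesis
      using V cl by (simp add: lcs_lie_algebra_def lcs_eq_on_iff br' \<Omega>')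
  qed
  ultimately have "lcs_lie_algebra n (f ` V) br' \<Omega>' \<theta>'"
    using V lie_algebra_on_transport[OF lie f, of br'] br' dim_image_lin_on[OF f(1) sub f(2)]
    by (simp add: lcs_lie_algebra_def)
  moreover have "lie_hom_on V br (f ` V) br' f"
    using f(1) br' by (simp add: lie_hom_on_def)
  ultimately show ?thesis
    unfolding lcs_isomorphic_def using V f(2) \<Omega>' \<theta>'
    by (intro conjI exI[of _ f]) (simp_all add: bij_betw_def)
qed

section \<open>Complements and duals\<close>

lemma projection_along_subspace:
  fixes V :: "'a::real_vector set"
  assumes V: "finite_dim_subspace V" and J: "subspace J" "J \<subseteq> V"
  obtains P where "linear P" "\<And>x. x \<in> V \<Longrightarrow> P x \<in> V" "\<And>x. x \<in> V \<Longrightarrow> x - P x \<in> J"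
    "\<And>x. x \<in> J \<Longrightarrow> P x = 0" "\<And>x. x \<in> V \<Longrightarrow> P (P x) = P x" "dim (P ` V) + dim J = dim V"
proof -
  obtain E where E: "subspace V" "finite E" "V = span E"
    using V by (auto simp: finite_dim_subspace_def)
  obtain C where C: "C \<subseteq> J" "independent C" "J \<subseteq> span C" "card C = dim J"
    using basis_exists[of J] by metis
  obtain B where B: "C \<subseteq> B" "B \<subseteq> V" "independent B" "V \<subseteq> span B"
    using maximal_independent_subset_extend[of C V] C(1,2) J(2) by blast
  have spC: "span C = J" and spB: "span B = V"
    using C B(2,4) J(1) E(1) by (simp_all add: span_minimal subset_antisym)
  have finB: "finite B"
    using independent_span_bound[OF E(2) B(3)] B(2) E(3) by simp
  obtain P where P: "linear P" "\<forall>b\<in>B. P b = (if b \<in> C then 0 else b)"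
    using linear_independent_extend[OF B(3), of "\<lambda>b. if b \<in> C then 0 else b"] by blast
  have P0: "P x = 0" if "x \<in> J" for x
    using that P(2) B(1) spC by (intro linear_eq_0_on_span[OF P(1), of C x]) auto
  have *: "P x \<in> V \<and> x - P x \<in> J \<and> P (P x) = P x" if "x \<in> V" for x
    using that[folded spB]
  proof (induction rule: span_induct_alt)
    case base
    then show ?case
      using P(1) E(1) J(1) by (simp add: linear_0 subspace_0)
  next
    case (step c b y)
    have b: "P b \<in> V \<and> b - P b \<in> J \<and> P (P b) = P b"
      using step(1) P B C(1) E(1) J(1) by (auto simp: linear_0 subspace_0)
    have "c *\<^sub>R b + y - P (c *\<^sub>R b + y) = c *\<^sub>R (b - P b) + (y - P y)"
      using P(1) by (simp add: linear_add linear_scale algebra_simps)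
    also have "\<dots> \<in> J"
      using b step(2) J(1) by (simp add: subspace_add subspace_scale del: scaleR_diff_right)
    finally show ?case
      using b step(2) P(1) E(1)
      by (simp add: linear_add linear_scale subspace_add subspace_scale)
  qed
  have "P ` V = span (P ` B)"
    using linear_span_image[OF P(1), of B] spB by simp
  also have "\<dots> = span (B - C)"
  proof -
    have "P ` B \<subseteq> insert 0 (B - C)" "B - C \<subseteq> P ` B"
      using P(2) by force+
    then show ?thesis
      by (metis span_insert_0 span_mono subset_antisym)
  qed
  finally have "dim (P ` V) = card (B - C)"
    using B(3) by (metis Diff_subset dim_span_eq_card_independent independent_mono)
  moreover have "card (B - C) + card C = card B"
    using B(1) finB by (metis card_Diff_subset card_mono finite_subset le_add_diff_inverse2)
  moreover have "dim V = card B"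
    using B(3) spB dim_span_eq_card_independent by blast
  ultimately show thesis
    using that[of P] P(1) P0 * C(4) by simp
qed

lemma sum_fun_apply_real: "(\<Sum>i\<in>I. f i) x = (\<Sum>i\<in>I. f i x)"
  for f :: "'i \<Rightarrow> 'a \<Rightarrow> real"
  by (induction I rule: infinite_finite_induct) simp_all

text \<open>A functional is the combination of the coordinate functionals of \<open>B\<close> whose
  coefficients are its values on \<open>B\<close>. A spanning set of bounded size is all that the
  dimension argument for \<open>image_eq_dual_space\<close> uses.\<close>

lemma dual_space_spanned:
  fixes B :: "'a::real_vector set"
  assumes "finite B" "independent B"
  obtains E where "finite E" "card E \<le> card B" "dual_space (span B) \<subseteq> span E"
proof
  \<comment> \<open>Coordinate functionals of \<open>B\<close>, extended by 0 in keeping with the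
    encoding of \<open>dual_space\<close>.\<close>
  define e where "e b = (\<lambda>x. if x \<in> span B then representation B x b else 0)" for b
  show "finite (e ` B)" "card (e ` B) \<le> card B"
    using assms(1) by (auto intro: card_image_le)
  show "dual_space (span B) \<subseteq> span (e ` B)"
  proof
    fix \<phi> assume \<phi>: "\<phi> \<in> dual_space (span B)"
    have "\<phi> = (\<Sum>b\<in>B. \<phi> b *\<^sub>R e b)"
    proof
      fix x
      show "\<phi> x = (\<Sum>b\<in>B. \<phi> b *\<^sub>R e b) x"
      proof (cases "x \<in> span B")
        case True
        then have "x = (\<Sum>b\<in>B. representation B x b *\<^sub>R b)"
          using sum_representation_eq[OF assms(2) True assms(1)] by simp
        then have "\<phi> x = \<phi> (\<Sum>b\<in>B. representation B x b *\<^sub>R b)"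
          by simp
        also have "\<dots> = (\<Sum>b\<in>B. representation B x b *\<^sub>R \<phi> b)"
          using \<phi> by (intro lin_on_sum[where V = "span B"]) (auto simp: dual_space_def span_base)
        finally show ?thesis
          using True by (simp add: sum_fun_apply_real scaleR_fun_def e_def mult.commute)
      next
        case False
        then show ?thesis
          using \<phi> by (simp add: sum_fun_apply_real scaleR_fun_def e_def dual_space_def)
      qed
    qed
    also have "\<dots> \<in> span (e ` B)"
      by (intro span_sum span_scale span_base) auto
    finally show "\<phi> \<in> span (e ` B)" .
  qed
qed

text \<open>The image has dimension \<open>dim K\<close>, while the dual lies in the span of at most
  \<open>dim K\<close> functionals. By exchange, a basis of the image already spans the
  dual.\<close>

lemma image_eq_dual_space:
  fixes K :: "'a::real_vector set" and J :: "'b::real_vector set"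
  assumes K: "finite_dim_subspace K" and J: "subspace J" "dim J = dim K"
    and h: "lin_on J h" "inj_on h J" "h ` J \<subseteq> dual_space K"
  shows "h ` J = dual_space K"
proof -
  obtain E where E: "subspace K" "finite E" "K = span E"
    using K by (auto simp: finite_dim_subspace_def)
  obtain B where B: "B \<subseteq> K" "independent B" "K \<subseteq> span B" "card B = dim K"
    using basis_exists[of K] by metis
  have "finite B"
    using independent_span_bound[OF E(2) B(2)] B(1) E(3) by simp
  then obtain D where D: "finite D" "card D \<le> card B" "dual_space (span B) \<subseteq> span D"
    using dual_space_spanned B(2) by blast
  have spB: "span B = K"
    using B(1,3) E(1) by (simp add: span_minimal subset_antisym)
  obtain C where C: "C \<subseteq> h ` J" "independent C" "h ` J \<subseteq> span C" "card C = dim (h ` J)"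
    using basis_exists[of "h ` J"] by metis
  obtain l where l: "linear l" "\<And>x. x \<in> J \<Longrightarrow> l x = h x"
    using lin_on_extend[OF h(1) J(1)] by blast
  have "subspace (h ` J)"
    using linear_subspace_image[OF l(1) J(1)] l(2) by simp
  have "span D \<subseteq> span C"
    using C D(1,2,3) h(3) spB dim_image_lin_on[OF h(1) J(1) h(2)] J(2) B(4)
    by (intro span_subset_span_if_card_le) auto
  also have "\<dots> \<subseteq> h ` J"
    using C(1) \<open>subspace (h ` J)\<close> by (rule span_minimal)
  finally show ?thesis
    using D(3) spB h(3) by blast
qed


section \<open>Lagrangian ideals\<close>

text \<open>In the lcs equation on \<open>x\<close>, \<open>y\<close> in \<open>J\<close> and
  \<open>z\<close> in \<open>G\<close>, the terms with \<open>br x z\<close> and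
  \<open>br y z\<close> vanish because these brackets stay in the isotropic \<open>J\<close>. The
  right-hand side vanishes too, so \<open>br x y\<close> lies in the radical of
  \<open>\<Omega>\<close>.\<close>

lemma lagrangian_ideal_abelian:
  assumes G: "lcs_lie_algebra n G br \<Omega> \<theta>" and J: "lagrangian_ideal n G br \<Omega> J"
    and ker: "J \<subseteq> {x \<in> G. \<theta> x = 0}"
    and nondeg: "\<And>x. x \<in> G \<Longrightarrow> (\<And>y. y \<in> G \<Longrightarrow> \<Omega> x y = 0) \<Longrightarrow> x = 0"
    and xy: "x \<in> J" "y \<in> J"
  shows "br x y = 0"
proof (rule nondeg)
  have lie: "lie_algebra_on G br"
    using G by (simp add: lcs_lie_algebra_def)
  then have sub: "subspace G" and alt: "alt_bilin_on G br"
    by (auto simp: lie_algebra_on_def finite_dim_subspace_def)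
  have JG: "J \<subseteq> G" and id: "\<And>x y. x \<in> G \<Longrightarrow> y \<in> J \<Longrightarrow> br x y \<in> J" and sJ: "subspace J"
    and lag: "\<And>x y. x \<in> J \<Longrightarrow> y \<in> J \<Longrightarrow> \<Omega> x y = 0"
    using J by (auto simp: lagrangian_ideal_def lie_ideal_def)
  show "br x y \<in> G"
    using xy JG id by blast
  fix z assume z: "z \<in> G"
  have br_J: "br u z \<in> J" if "u \<in> J" for u
    using id[OF z that] alt_bilin_on_swap[OF alt sub z, of u] that JG subspace_neg[OF sJ]
    by (metis subsetD)
  have "wedge 1 2 (form1 \<theta>) (form2 \<Omega>) [x, y, z] = 0"
  proof -
    \<comment> \<open>If \<open>\<theta>\<close> receives \<open>z\<close>, then
      \<open>\<Omega>\<close> receives \<open>x\<close> and \<open>y\<close>, on which it is zero;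
      otherwise \<open>\<theta>\<close> receives a vector of its kernel.\<close>
    have *: "\<theta> ([x, y, z] ! \<sigma> 0) * \<Omega> ([x, y, z] ! \<sigma> 1) ([x, y, z] ! \<sigma> 2) = 0"
      if \<sigma>: "\<sigma> permutes {..<3}" for \<sigma>
    proof (cases "\<sigma> 0 = 2")
      case True
      have "\<sigma> 1 < 3" "\<sigma> 2 < 3" "\<sigma> 1 \<noteq> \<sigma> 0" "\<sigma> 2 \<noteq> \<sigma> 0"
        using permutes_in_image[OF \<sigma>] permutes_inj[OF \<sigma>] by (auto simp: inj_eq)
      then have "\<sigma> 1 \<in> {0, 1}" "\<sigma> 2 \<in> {0, 1}"
        using True by auto
      then show ?thesis
        using xy lag by auto
    next
      case False
      have "\<sigma> 0 < 3"
        using permutes_in_image[OF \<sigma>, of 0] by simp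
      then have "\<sigma> 0 \<in> {0, 1}"
        using False by auto
      then show ?thesis
        using xy ker by auto
    qed
    have "form1 \<theta> (map (\<lambda>i. [x, y, z] ! \<sigma> i) [0..<1]) *
        form2 \<Omega> (map (\<lambda>i. [x, y, z] ! \<sigma> i) [1..<1 + 2]) = 0"
      if "\<sigma> permutes {..<1 + 2}" for \<sigma>
      using *[of \<sigma>] that by (simp add: form1_def form2_def numeral_2_eq_2 numeral_3_eq_3)
    then show ?thesis
      unfolding wedge_def mult.assoc by (subst sum.neutral) (simp_all del: mult_eq_0_iff)
  qed
  moreover have "- \<Omega> (br x y) z + \<Omega> (br x z) y - \<Omega> (br y z) x =
      wedge 1 2 (form1 \<theta>) (form2 \<Omega>) [x, y, z]"
    using G xy z JG unfolding lcs_lie_algebra_def lcs_eq_on_iff by blast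
  ultimately show "\<Omega> (br x y) z = 0"
    using lag br_J xy by simp
qed

theorem proposition1p17:
  fixes n :: nat
    and G :: "'a::real_vector set"
    and br :: "'a \<Rightarrow> 'a \<Rightarrow> 'a"
    and \<Omega> :: "'a \<Rightarrow> 'a \<Rightarrow> real"
    and \<theta> :: "'a \<Rightarrow> real"
    and J :: "'a set"
  assumes "lcs_lie_algebra n G br \<Omega> \<theta>"
    and "lagrangian_ideal n G br \<Omega> J"
    and "J \<subseteq> {x \<in> G. \<theta> x = 0}"
  shows "\<exists>(H :: 'a set) brh \<theta>h br0.
           lie_algebra_on H brh \<and> lin_on H \<theta>h \<and> closed_1form_on H brh \<theta>h \<and>
           solves_cotangent_extension H brh \<theta>h br0 \<and>
           lcs_isomorphic n G br \<Omega> \<theta>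
             (cotangent_space H) br0 cotangent_Omega (cotangent_theta \<theta>h)"
proof -

  \<comment> \<open>Data of the lcs Lie algebra and of the ideal\<close>
  have lie: "lie_algebra_on G br" and alt: "alt_bilin_on G \<Omega>" and \<theta>: "lin_on G \<theta>"
    and dimG: "dim G = 2 * n" and n: "n > 0" and closed: "closed_1form_on G br \<theta>"
    and ne: "\<not> form_eq_on G (2 * n) (wedge_power 2 (form2 \<Omega>) n) (\<lambda>_. 0)"
    using assms(1) by (auto simp: lcs_lie_algebra_def)
  have fin: "finite_dim_subspace G" and sub: "subspace G" and altb: "alt_bilin_on G br"
    and cl: "\<And>x y. x \<in> G \<Longrightarrow> y \<in> G \<Longrightarrow> br x y \<in> G"
    using lie by (auto simp: lie_algebra_on_def finite_dim_subspace_def)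
  have JG: "J \<subseteq> G" and id: "\<And>x y. x \<in> G \<Longrightarrow> y \<in> J \<Longrightarrow> br x y \<in> J" and sJ: "subspace J"
    and lag: "\<And>x y. x \<in> J \<Longrightarrow> y \<in> J \<Longrightarrow> \<Omega> x y = 0" and dimJ: "dim J = n"
    and ker: "\<And>x. x \<in> J \<Longrightarrow> \<theta> x = 0"
    using assms(2,3) by (auto simp: lagrangian_ideal_def lie_ideal_def)
  have id': "br y x \<in> J" if "x \<in> G" "y \<in> J" for x y
    using id[OF that] alt_bilin_on_swap[OF altb sub that(1), of y] that(2) JG subspace_neg[OF sJ]
    by (metis subsetD)
  note nondeg = wedge_power_nonzero_imp_nondegenerate[OF fin alt dimG n ne]
  have abel: "br x y = 0" if "x \<in> J" "y \<in> J" for x y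
    using lagrangian_ideal_abelian[OF assms nondeg that] by blast
  have \<Omega>l: "lin_on G (\<Omega> x)" "lin_on G (\<lambda>y. \<Omega> y x)" if "x \<in> G" for x
    using alt that by (auto simp: alt_bilin_on_def)
  have bl: "lin_on G (br x)" "lin_on G (\<lambda>y. br y x)" if "x \<in> G" for x
    using altb that by (auto simp: alt_bilin_on_def)

  \<comment> \<open>A complement of the ideal\<close>
  obtain P where P: "linear P" and PG: "\<And>x. x \<in> G \<Longrightarrow> P x \<in> G"
    and PJ: "\<And>x. x \<in> G \<Longrightarrow> x - P x \<in> J" and P0: "\<And>x. x \<in> J \<Longrightarrow> P x = 0"
    and PP: "\<And>x. x \<in> G \<Longrightarrow> P (P x) = P x" and dimP: "dim (P ` G) + dim J = dim G"
    using projection_along_subspace[OF fin sJ JG] by blast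
  \<comment> \<open>\<open>K\<close> stands for the quotient of \<open>G\<close> by
    \<open>J\<close>, so that \<open>H\<close> can be a subspace of the same type
    \<open>'a\<close>.\<close>
  define K where "K = P ` G"
  have KG: "K \<subseteq> G" and PK: "\<And>x. x \<in> K \<Longrightarrow> P x = x" and dimK: "dim K = n"
    using PG PP dimP dimJ dimG by (auto simp: K_def)
  have Pl: "lin_on A P" for A
    using P by (simp add: lin_on_def linear_add linear_scale)
  have sK: "subspace K"
    unfolding K_def by (rule linear_subspace_image[OF P sub])
  have finK: "finite_dim_subspace K"
    unfolding K_def by (rule finite_dim_subspace_image[OF Pl fin])
  have Pz: "P x = 0 \<longleftrightarrow> x \<in> J" if "x \<in> G" for x
    using PJ[OF that] P0 by auto
  have P_eq: "P x = P y" if "x - y \<in> J" for x y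
    using P0[OF that] P by (simp add: linear_diff)
  \<comment> \<open>Since \<open>J\<close> is an ideal, the bracket modulo \<open>J\<close> depends
    only on the classes of its arguments.\<close>
  have Pbr: "P (br (P x) (P y)) = P (br x y)" if "x \<in> G" "y \<in> G" for x y
  proof -
    have "br x y - br (P x) (P y) = br (x - P x) y + br (P x) (y - P y)"
      using that PG lin_on_diff[OF bl(2)[of y] sub, of x "P x"]
        lin_on_diff[OF bl(1)[of "P x"] sub, of y "P y"] by simp
    also have "\<dots> \<in> J"
      using that PG PJ id id' sJ by (simp add: subspace_add)
    finally show ?thesis
      using P_eq by metis
  qed
  \<comment> \<open>This is where \<open>J\<close> lying in the kernel lets \<open>\<theta>\<close>
    descend to the quotient; its restriction to \<open>K\<close> serves as
    \<open>\<theta>h\<close>.\<close>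
  have \<theta>P: "\<theta> (P x) = \<theta> x" if "x \<in> G" for x
    using ker[OF PJ[OF that]] lin_on_diff[OF \<theta> sub that PG[OF that]] by simp

  \<comment> \<open>The quotient Lie algebra on the complement\<close>
  define brh where "brh x y = P (br x y)" for x y
  have lieK: "lie_algebra_on K brh"
  proof -
    have "alt_bilin_on K brh"
      using altb KG P cl unfolding alt_bilin_on_def lin_on_def brh_def
      by (auto simp: subset_iff linear_add linear_scale linear_0)
    moreover have "brh x (brh y z) + brh y (brh z x) + brh z (brh x y) = 0"
      if xyz: "x \<in> K" "y \<in> K" "z \<in> K" for x y z
    proof -
      \<comment> \<open>The inner projection may be dropped by \<open>Pbr\<close>, so the Jacobi sum
        on \<open>K\<close> is the projection of the one on \<open>G\<close>.\<close>
      have *: "brh u (brh v w) = P (br u (br v w))" if "u \<in> K" "v \<in> K" "w \<in> K" for u v w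
        using Pbr[of u "br v w"] that PK KG cl unfolding brh_def by (simp add: subset_iff)
      have "brh x (brh y z) + brh y (brh z x) + brh z (brh x y) =
          P (br x (br y z) + br y (br z x) + br z (br x y))"
        using xyz P by (simp add: * linear_add)
      also have "\<dots> = 0"
        using lie xyz KG P by (simp add: lie_algebra_on_def subset_iff linear_0)
      finally show ?thesis .
    qed
    moreover have "brh x y \<in> K" if "x \<in> K" "y \<in> K" for x y
      using subsetD[OF KG that(1)] subsetD[OF KG that(2)] by (simp add: brh_def K_def cl)
    ultimately show ?thesis
      using finK by (simp add: lie_algebra_on_def)
  qed
  have \<theta>K: "lin_on K \<theta>"
    using \<theta> KG by (rule lin_on_subset)
  have closedK: "closed_1form_on K brh \<theta>"
    using closed KG cl by (auto simp: closed_1form_on_iff brh_def \<theta>P subset_iff)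

  \<comment> \<open>Identification of the ideal with the dual of the complement\<close>
  define h where "h x = (\<lambda>k. if k \<in> K then \<Omega> x k else 0)" for x
  have hl: "lin_on G h"
    using \<Omega>l KG unfolding lin_on_def h_def by (auto simp: fun_eq_iff scaleR_fun_def subset_iff)
  have h_dual: "h x \<in> dual_space K" if "x \<in> G" for x
  proof -
    have "lin_on K (h x)"
      using lin_on_subset[OF \<Omega>l(1)[OF that] KG] lin_on_cong[OF sK, of "h x" "\<Omega> x"]
      by (simp add: h_def)
    then show ?thesis
      by (simp add: dual_space_def h_def)
  qed
  \<comment> \<open>For \<open>x - y\<close> in the isotropic \<open>J\<close>, the value
    \<open>\<Omega> (x - y) z\<close> depends only on \<open>P z\<close>. Vanishing on
    \<open>K\<close> therefore means vanishing on \<open>G\<close>, and nondegeneracy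
    applies.\<close>
  have h_inj: "inj_on h J"
  proof (rule inj_onI)
    fix x y assume xy: "x \<in> J" "y \<in> J" "h x = h y"
    have d: "x - y \<in> J"
      using xy sJ by (simp add: subspace_diff)
    have "\<Omega> (x - y) z = 0" if z: "z \<in> G" for z
    proof -
      have "P z \<in> K"
        using z by (simp add: K_def)
      then have "\<Omega> x (P z) = \<Omega> y (P z)"
        using fun_cong[OF xy(3), of "P z"] by (simp add: h_def)
      then have "\<Omega> (x - y) (P z) = 0"
        using lin_on_diff[OF \<Omega>l(2)[OF PG[OF z]] sub, of x y] xy JG by auto
      moreover have "\<Omega> (x - y) (z - P z) = 0"
        using lag[OF d PJ[OF z]] .
      ultimately show ?thesis
        using lin_on_diff[OF \<Omega>l(1) sub z PG[OF z], of "x - y"] d JG by auto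
    qed
    then show "x = y"
      using nondeg[of "x - y"] d JG by auto
  qed
  have hJ: "h ` J = dual_space K"
    using image_eq_dual_space[OF finK sJ _ lin_on_subset[OF hl JG] h_inj] h_dual JG dimJ dimK
    by auto

  \<comment> \<open>The isomorphism onto the cotangent space\<close>
  define F where "F x = (h (x - P x) + (1 / 2) *\<^sub>R h (P x), P x)" for x
  have FJ: "F x = (h x, 0)" if "x \<in> J" for x
    using P0[OF that] lin_on_zero[OF hl sub] by (simp add: F_def)
  have Fl: "lin_on G F"
    unfolding lin_on_def
  proof (intro conjI ballI allI)
    fix x y assume xy: "x \<in> G" "y \<in> G"
    have e: "x + y - P (x + y) = (x - P x) + (y - P y)"
      using P by (simp add: linear_add)
    have "h (x + y - P (x + y)) = h (x - P x) + h (y - P y)"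
      unfolding e using lin_on_add[OF hl, of "x - P x" "y - P y"] xy PG sub by (simp add: subspace_diff)
    moreover have "h (P (x + y)) = h (P x) + h (P y)"
      using lin_on_add[OF hl, of "P x" "P y"] xy PG P by (simp add: linear_add)
    ultimately show "F (x + y) = F x + F y"
      using P by (simp add: F_def linear_add scaleR_add_right)
  next
    fix c x assume x: "x \<in> G"
    have e: "c *\<^sub>R x - P (c *\<^sub>R x) = c *\<^sub>R (x - P x)"
      using P by (simp add: linear_scale scaleR_diff_right)
    have "h (c *\<^sub>R x - P (c *\<^sub>R x)) = c *\<^sub>R h (x - P x)"
      unfolding e using lin_on_scale[OF hl, of "x - P x" c] x PG sub by (simp add: subspace_diff)
    moreover have "h (P (c *\<^sub>R x)) = c *\<^sub>R h (P x)"
      using lin_on_scale[OF hl, of "P x" c] x PG P by (simp add: linear_scale)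
    ultimately show "F (c *\<^sub>R x) = c *\<^sub>R F x"
      using P by (simp add: F_def linear_scale scaleR_add_right)
  qed
  have F\<Omega>: "cotangent_Omega (F x) (F y) = \<Omega> x y" if x: "x \<in> G" and y: "y \<in> G" for x y
  proof -
    let ?a = "x - P x" and ?b = "y - P y"
    have G: "?a \<in> G" "?b \<in> G" "P x \<in> G" "P y \<in> G"
      using PJ PG JG x y by auto
    have "\<Omega> x y = \<Omega> (?a + P x) (?b + P y)"
      by simp
    also have "\<dots> = \<Omega> ?a ?b + \<Omega> ?a (P y) + \<Omega> (P x) ?b + \<Omega> (P x) (P y)"
      using G lin_on_add[OF \<Omega>l(2), of "?b + P y" ?a "P x"] lin_on_add[OF \<Omega>l(1), of ?a ?b "P y"]
        lin_on_add[OF \<Omega>l(1), of "P x" ?b "P y"] sub y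
      by (simp del: diff_add_cancel add: subspace_add)
    also have "\<dots> = \<Omega> ?a (P y) - \<Omega> ?b (P x) + \<Omega> (P x) (P y)"
      using lag[OF PJ[OF x] PJ[OF y]] alt_bilin_on_swap[OF alt sub G(2,3)] by simp
    \<comment> \<open>The factor 1/2 is right because the canonical form is antisymmetrised: by
      skew-symmetry, half of \<open>\<Omega> (P x) (P y)\<close> minus half of
      \<open>\<Omega> (P y) (P x)\<close> is the whole of
      \<open>\<Omega> (P x) (P y)\<close>.\<close>
    also have "\<dots> = cotangent_Omega (F x) (F y)"
      using alt_bilin_on_swap[OF alt sub G(3,4)] x y
      by (simp add: cotangent_Omega_def F_def h_def K_def scaleR_fun_def)
    finally show ?thesis ..
  qed
  \<comment> \<open>A map that preserves a nondegenerate form is injective.\<close>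
  have Finj: "inj_on F G"
  proof (rule inj_onI)
    fix x y assume xy: "x \<in> G" "y \<in> G" "F x = F y"
    have "\<Omega> (x - y) z = 0" if "z \<in> G" for z
      using lin_on_diff[OF \<Omega>l(2)[OF that] sub xy(1,2)] F\<Omega>[OF xy(1) that] F\<Omega>[OF xy(2) that] xy(3)
      by simp
    then show "x = y"
      using nondeg[of "x - y"] xy(1,2) sub by (simp add: subspace_diff)
  qed
  \<comment> \<open>\<open>J\<close> is the image of \<open>G\<close> under the complementary
    projection.\<close>
  have finJ: "finite_dim_subspace J"
  proof -
    have "(\<lambda>x. x - P x) ` G = J"
      using PJ P0 JG by force
    moreover have "lin_on G (\<lambda>x. x - P x)"
      using P by (simp add: lin_on_def linear_add linear_scale scaleR_diff_right)
    ultimately show ?thesis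
      using finite_dim_subspace_image[OF _ fin] by metis
  qed
  have dual_fin: "finite_dim_subspace (dual_space K)"
    using finite_dim_subspace_image[OF lin_on_subset[OF hl JG] finJ] hJ by simp
  then have dual_sub: "subspace (dual_space K)"
    by (simp add: finite_dim_subspace_def)
  have FG: "F ` G = cotangent_space K"
  proof
    show "F ` G \<subseteq> cotangent_space K"
      using h_dual PG sub dual_sub
      by (auto simp: F_def cotangent_space_def K_def subspace_add subspace_scale subspace_diff)
    show "cotangent_space K \<subseteq> F ` G"
    proof
      fix u assume "u \<in> cotangent_space K"
      then obtain \<phi> X where u: "u = (\<phi>, X)" "\<phi> \<in> dual_space K" "X \<in> K"
        by (auto simp: cotangent_space_def)
      \<comment> \<open>\<open>F X\<close> already has second component \<open>X\<close>. The error
        in the first component is a functional on \<open>K\<close>, hence \<open>h j\<close> for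
        some \<open>j\<close> in \<open>J\<close>, and adding \<open>j\<close> leaves the second
        component unchanged.\<close>
      have "\<phi> - fst (F X) \<in> dual_space K"
        using u h_dual KG PK dual_sub sub
        by (auto simp: F_def subset_iff subspace_diff subspace_scale lin_on_zero[OF hl sub])
      then obtain j where j: "j \<in> J" "h j = \<phi> - fst (F X)"
        using hJ by (metis imageE)
      have G: "j \<in> G" "X \<in> G"
        using j(1) u(3) JG KG by auto
      have "F (j + X) = F j + F X"
        using lin_on_add[OF Fl G] .
      also have "\<dots> = (\<phi> - fst (F X), 0) + (fst (F X), X)"
        using FJ[OF j(1)] j(2) PK[OF u(3)] by (simp add: F_def lin_on_zero[OF hl sub])
      also have "\<dots> = u"
        using u(1) by simp
      finally show "u \<in> F ` G"
        using G sub by (metis imageI subspace_add)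
    qed
  qed

  \<comment> \<open>The transported bracket and the extension\<close>
  define br0 where "br0 u v = F (br (inv_into G F u) (inv_into G F v))" for u v
  \<comment> \<open>Injectivity makes \<open>inv_into\<close> exact on the image of
    \<open>G\<close>; values of \<open>br0\<close> elsewhere are arbitrary.\<close>
  have br0: "br0 (F x) (F y) = F (br x y)" if "x \<in> G" "y \<in> G" for x y
    using that Finj by (simp add: br0_def)
  have F\<theta>: "cotangent_theta \<theta> (F x) = \<theta> x" if "x \<in> G" for x
    using \<theta>P[OF that] by (simp add: cotangent_theta_def F_def)
  have iso: "lcs_isomorphic n G br \<Omega> \<theta> (cotangent_space K) br0 cotangent_Omega (cotangent_theta \<theta>)"
    unfolding FG[symmetric] using br0 F\<Omega> F\<theta>
    by (intro lcs_isomorphic_transport assms(1) Fl Finj)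
  then have W: "lcs_lie_algebra n (cotangent_space K) br0 cotangent_Omega (cotangent_theta \<theta>)"
    by (simp add: lcs_isomorphic_def)
  have "lie_short_exact (dual_space K) (\<lambda>_ _. 0) (\<lambda>\<phi>. (\<phi>, 0)) (cotangent_space K) br0 snd K brh"
  proof -
    have "lie_algebra_on (dual_space K) (\<lambda>_ _. 0)"
      using dual_fin dual_sub
      by (simp add: lie_algebra_on_def alt_bilin_on_def lin_on_def subspace_0)
    moreover have "lie_hom_on (dual_space K) (\<lambda>_ _. 0) (cotangent_space K) br0 (\<lambda>\<phi>. (\<phi>, 0))"
    proof -
      \<comment> \<open>The dual summand is the image of \<open>J\<close> under \<open>F\<close>, so
        its bracket vanishes because \<open>J\<close> is abelian.\<close>
      have "br0 (\<phi>, 0) (\<psi>, 0) = 0" if "\<phi> \<in> dual_space K" "\<psi> \<in> dual_space K" for \<phi> \<psi>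
      proof -
        obtain x y where xy: "x \<in> J" "\<phi> = h x" "y \<in> J" "\<psi> = h y"
          using \<open>\<phi> \<in> dual_space K\<close> \<open>\<psi> \<in> dual_space K\<close> unfolding hJ[symmetric] by blast
        have "br0 (\<phi>, 0) (\<psi>, 0) = F (br x y)"
          using br0[of x y] xy JG FJ by auto
        also have "\<dots> = 0"
          using abel xy lin_on_zero[OF Fl sub] by simp
        finally show ?thesis .
      qed
      then show ?thesis
        using subspace_0[OF sK]
        by (auto simp: lie_hom_on_def cotangent_space_def lin_on_def zero_prod_def)
    qed
    moreover have "lie_hom_on (cotangent_space K) br0 K brh snd"
    proof -
      \<comment> \<open>The composite of \<open>snd\<close> with \<open>F\<close> is
        \<open>P\<close>, so this is \<open>Pbr\<close> read through \<open>F\<close>.\<close>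
      have "snd (br0 u v) = brh (snd u) (snd v)"
        if "u \<in> cotangent_space K" "v \<in> cotangent_space K" for u v
      proof -
        obtain x y where "x \<in> G" "u = F x" "y \<in> G" "v = F y"
          using \<open>u \<in> cotangent_space K\<close> \<open>v \<in> cotangent_space K\<close> unfolding FG[symmetric] by blast
        then show ?thesis
          using br0 Pbr by (simp add: brh_def F_def)
      qed
      then show ?thesis
        by (auto simp: lie_hom_on_def cotangent_space_def lin_on_def)
    qed
    moreover have "lie_algebra_on (cotangent_space K) br0"
      using W by (simp add: lcs_lie_algebra_def)
    ultimately show ?thesis
      using lieK subspace_0[OF sK] subspace_0[OF dual_sub]
      by (auto simp: lie_short_exact_def cotangent_space_def inj_on_def)
  qed
  then have "solves_cotangent_extension K brh \<theta> br0"
    using W by (simp add: solves_cotangent_extension_def lcs_lie_algebra_def)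
  then show ?thesis
    using lieK \<theta>K closedK iso by blast
qed

end
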